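(* Let $\alpha,\beta$ be positive constants, $J\subset\mathbb{R}$ an open interval, and $f,g:J\to\mathbb{R}$ smooth functions. (i) Suppose $\alpha^2 f^2(u)-\beta^2 g^2(u)>0$ and $f'^2(u)+g'^2(u)>0$ for all $u\in J$, and let $\mathcal{M}_1$ be the general rotational surface of first type determined by $f,g,\alpha,\beta$ in the Minkowski space $\mathbb{R}^4_1$. Then $\mathcal{M}_1$ is flat if and only if on $J$ $$\alpha^2 \beta^2 (f'^2 + g'^2) (g f' - f g')^2 = (\alpha^2 f^2 - \beta^2 g^2)(\alpha^2 f g' + \beta^2 g f')(g' f'' - f' g'').$$ (ii) Suppose $f'^2(u)-g'^2(u)>0$ and $\alpha^2 f^2(u)+\beta^2 g^2(u)>0$ for all $u\in J$, and let $\mathcal{M}_2$ be the general rotational surface of second type determined by $f,g,\alpha,\beta$ in $\mathbb{R}^4_1$. Then $\mathcal{M}_2$ is flat if and only if on $J$ $$\alpha^2 \beta^2 (f'^2 - g'^2) (g f' - f g')^2 = (\alpha^2 f^2 + \beta^2 g^2)(\alpha^2 f g' + \beta^2 g f')(g' f'' - f' g'').$$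
   Context: $\mathbb{R}^4_1$ is $\mathbb{R}^4$ with the metric $\langle x,y\rangle=x_1y_1+x_2y_2+x_3y_3-x_4y_4$. A surface in $\mathbb{R}^4_1$ is spacelike if the induced metric is Riemannian. The general rotational surface of first type is the spacelike surface $$\mathcal{M}_1:\ z(u,v)=\left(f(u)\cos\alpha v,\ f(u)\sin\alpha v,\ g(u)\cosh\beta v,\ g(u)\sinh\beta v\right),\quad u\in J,\ v\in[0,2\pi),$$ where $\alpha^2 f^2-\beta^2 g^2>0$ and $f'^2+g'^2>0$. The general rotational surface of second type is the spacelike surface $$\mathcal{M}_2:\ z(u,v)=\left(f(u)\cos\alpha v,\ f(u)\sin\alpha v,\ g(u)\sinh\beta v,\ g(u)\cosh\beta v\right),\quad u\in J,\ v\in[0,2\pi),$$ where $f'^2-g'^2>0$ and $\alpha^2 f^2+\beta^2 g^2>0$. A surface is called flat if the Gauss curvature $K$ of its induced metric vanishes identically. *)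

theory Defs
  imports "HOL-Analysis.Analysis"
begin

definition smooth_on :: "real set \<Rightarrow> (real \<Rightarrow> real) \<Rightarrow> bool" where
  "smooth_on J f \<longleftrightarrow> (\<forall>n. \<forall>u\<in>J. (deriv ^^ n) f differentiable (at u))"
  \<comment> \<open>meant for open \<open>J\<close>: the iterated derivatives at points of \<open>J\<close> then depend only on \<open>f\<close> on \<open>J\<close>\<close>

definition mink :: "real ^ 4 \<Rightarrow> real ^ 4 \<Rightarrow> real" where
  "mink x y = x$1 * y$1 + x$2 * y$2 + x$3 * y$3 - x$4 * y$4"


subsection \<open>Intrinsic geometry of a parametrized surface\<close>

text \<open>
  A parametrized surface is a map \<open>z\<close> from parameter points \<open>x = (x$1, x$2)\<close> to
  \<open>real ^ 4\<close>, together with a parameter domain \<open>D\<close>.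
\<close>

definition partial :: "2 \<Rightarrow> (real ^ 2 \<Rightarrow> 'a::real_normed_vector) \<Rightarrow> real ^ 2 \<Rightarrow> 'a" where
  "partial i F x = vector_derivative (\<lambda>t. F (x + t *\<^sub>R axis i 1)) (at 0)"

definition induced_metric :: "(real ^ 2 \<Rightarrow> real ^ 4) \<Rightarrow> real ^ 2 \<Rightarrow> real ^ 2 ^ 2" where
  "induced_metric z x = (\<chi> i j. mink (partial i z x) (partial j z x))"

definition spacelike_on :: "(real ^ 2) set \<Rightarrow> (real ^ 2 \<Rightarrow> real ^ 4) \<Rightarrow> bool" where
  "spacelike_on D z \<longleftrightarrow> (\<forall>x\<in>D. \<forall>w. w \<noteq> 0 \<longrightarrow> w \<bullet> (induced_metric z x *v w) > 0)"

text \<open>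
  The Christoffel symbol \<open>\<Gamma>\<close> with upper index \<open>k\<close> and lower indices \<open>i\<close>, \<open>j\<close>
  of a metric \<open>G\<close>.
\<close>

definition christoffel :: "(real ^ 2 \<Rightarrow> real ^ 2 ^ 2) \<Rightarrow> 2 \<Rightarrow> 2 \<Rightarrow> 2 \<Rightarrow> real ^ 2 \<Rightarrow> real" where
  "christoffel G k i j x =
     (\<Sum>l\<in>UNIV. matrix_inv (G x) $ k $ l *
        (partial i (\<lambda>y. G y $ j $ l) x + partial j (\<lambda>y. G y $ i $ l) x
         - partial l (\<lambda>y. G y $ i $ j) x)) / 2"

text \<open>
  \<open>riemann G l i j k x\<close> is the \<open>l\<close>-th component of \<open>R(\<partial>\<^sub>i, \<partial>\<^sub>j) \<partial>\<^sub>k\<close>, where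
  \<open>R(X, Y) = [\<nabla>\<^sub>X, \<nabla>\<^sub>Y] - \<nabla>\<close> along \<open>[X, Y]\<close>.
\<close>

definition riemann ::
    "(real ^ 2 \<Rightarrow> real ^ 2 ^ 2) \<Rightarrow> 2 \<Rightarrow> 2 \<Rightarrow> 2 \<Rightarrow> 2 \<Rightarrow> real ^ 2 \<Rightarrow> real" where
  "riemann G l i j k x =
     partial i (christoffel G l j k) x - partial j (christoffel G l i k) x
     + (\<Sum>m\<in>UNIV. christoffel G l i m x * christoffel G m j k x
                - christoffel G l j m x * christoffel G m i k x)"

text \<open>
  The sectional curvature \<open>\<langle>R(\<partial>\<^sub>1, \<partial>\<^sub>2) \<partial>\<^sub>2, \<partial>\<^sub>1\<rangle> / det G\<close>, which is positive on round spheres.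
\<close>

definition gauss_curvature :: "(real ^ 2 \<Rightarrow> real ^ 2 ^ 2) \<Rightarrow> real ^ 2 \<Rightarrow> real" where
  "gauss_curvature G x = (\<Sum>l\<in>UNIV. G x $ 1 $ l * riemann G l 1 2 2 x) / det (G x)"

definition flat_on :: "(real ^ 2) set \<Rightarrow> (real ^ 2 \<Rightarrow> real ^ 4) \<Rightarrow> bool" where
  "flat_on D z \<longleftrightarrow> (\<forall>x\<in>D. gauss_curvature (induced_metric z) x = 0)"


subsection \<open>General rotational surfaces\<close>

text \<open>
  In both parametrizations \<open>x$1\<close> is \<open>u\<close> and \<open>x$2\<close> is \<open>v\<close>.  The formulas make sense for every
  real \<open>v\<close>, so derivatives in \<open>v\<close> are two-sided also at the end point \<open>v = 0\<close> of the
  parameter domain.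
\<close>

definition rot_domain :: "real set \<Rightarrow> (real ^ 2) set" where
  "rot_domain J = {x. x$1 \<in> J \<and> x$2 \<in> {0..<2 * pi}}"

definition rot_surface1 ::
    "real \<Rightarrow> real \<Rightarrow> (real \<Rightarrow> real) \<Rightarrow> (real \<Rightarrow> real) \<Rightarrow> real ^ 2 \<Rightarrow> real ^ 4" where
  "rot_surface1 \<alpha> \<beta> f g x =
     vector [f (x$1) * cos (\<alpha> * x$2), f (x$1) * sin (\<alpha> * x$2),
             g (x$1) * cosh (\<beta> * x$2), g (x$1) * sinh (\<beta> * x$2)]"

definition rot_surface2 ::
    "real \<Rightarrow> real \<Rightarrow> (real \<Rightarrow> real) \<Rightarrow> (real \<Rightarrow> real) \<Rightarrow> real ^ 2 \<Rightarrow> real ^ 4" where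
  "rot_surface2 \<alpha> \<beta> f g x =
     vector [f (x$1) * cos (\<alpha> * x$2), f (x$1) * sin (\<alpha> * x$2),
             g (x$1) * sinh (\<beta> * x$2), g (x$1) * cosh (\<beta> * x$2)]"


subsection \<open>The rotational surfaces are spacelike\<close>

lemma vector_4:
  "(vector [a, b, c, d] :: real ^ 4) $ 1 = a" "(vector [a, b, c, d] :: real ^ 4) $ 2 = b"
  "(vector [a, b, c, d] :: real ^ 4) $ 3 = c" "(vector [a, b, c, d] :: real ^ 4) $ 4 = d"
  by (simp_all add: vector_def)

lemma has_vector_derivative_vector_4:
  assumes "(a has_real_derivative a') (at t)" "(b has_real_derivative b') (at t)"
    "(c has_real_derivative c') (at t)" "(d has_real_derivative d') (at t)"
  shows "((\<lambda>t. vector [a t, b t, c t, d t] :: real ^ 4) has_vector_derivative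
           vector [a', b', c', d']) (at t)"
proof -
  have eq: "(vector [p, q, r, s] :: real ^ 4)
      = p *\<^sub>R axis 1 1 + q *\<^sub>R axis 2 1 + r *\<^sub>R axis 3 1 + s *\<^sub>R axis 4 1" for p q r s
    by (simp add: vec_eq_iff forall_4 vector_4 axis_def)
  show ?thesis
    unfolding eq
    by (auto intro!: derivative_eq_intros assms)
qed

lemma partial_rot_surface:
  fixes f g p q r s :: "real \<Rightarrow> real"
  defines "z \<equiv> (\<lambda>x::real^2. vector [f (x$1) * p (x$2), f (x$1) * q (x$2),
                         g (x$1) * r (x$2), g (x$1) * s (x$2)] :: real ^ 4)"
  shows "f differentiable (at (x$1)) \<Longrightarrow> g differentiable (at (x$1)) \<Longrightarrow>
      partial 1 z x = vector [deriv f (x$1) * p (x$2), deriv f (x$1) * q (x$2),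
                              deriv g (x$1) * r (x$2), deriv g (x$1) * s (x$2)]"
    and "(p has_real_derivative p') (at (x$2)) \<Longrightarrow> (q has_real_derivative q') (at (x$2)) \<Longrightarrow>
      (r has_real_derivative r') (at (x$2)) \<Longrightarrow> (s has_real_derivative s') (at (x$2)) \<Longrightarrow>
      partial 2 z x = vector [f (x$1) * p', f (x$1) * q', g (x$1) * r', g (x$1) * s']"
proof -
  have sh: "((\<lambda>t. h (c + t)) has_real_derivative h') (at 0)"
    if "(h has_real_derivative h') (at c)" for h :: "real \<Rightarrow> real" and h' c
    using that DERIV_shift[of h h' 0 c] by (simp add: add.commute)
  {
    assume "f differentiable (at (x$1))" "g differentiable (at (x$1))"
    then have f: "((\<lambda>t. f (x$1 + t)) has_real_derivative deriv f (x$1)) (at 0)"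
      and g: "((\<lambda>t. g (x$1 + t)) has_real_derivative deriv g (x$1)) (at 0)"
      by (auto intro!: sh simp: DERIV_deriv_iff_real_differentiable)
    show "partial 1 z x = vector [deriv f (x$1) * p (x$2), deriv f (x$1) * q (x$2),
                              deriv g (x$1) * r (x$2), deriv g (x$1) * s (x$2)]"
      unfolding partial_def z_def
      by (intro vector_derivative_at)
        (simp add: axis_def, intro has_vector_derivative_vector_4 DERIV_cmult_right f g)
  next
    assume *: "(p has_real_derivative p') (at (x$2))" "(q has_real_derivative q') (at (x$2))"
      "(r has_real_derivative r') (at (x$2))" "(s has_real_derivative s') (at (x$2))"
    show "partial 2 z x = vector [f (x$1) * p', f (x$1) * q', g (x$1) * r', g (x$1) * s']"
      unfolding partial_def z_def
      by (intro vector_derivative_at)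
        (simp add: axis_def, intro has_vector_derivative_vector_4 DERIV_cmult sh *)
  }
qed

lemma partial_rot_surface1:
  assumes "f differentiable (at (x$1))" "g differentiable (at (x$1))"
  shows "partial 1 (rot_surface1 \<alpha> \<beta> f g) x =
      vector [deriv f (x$1) * cos (\<alpha> * x$2), deriv f (x$1) * sin (\<alpha> * x$2),
              deriv g (x$1) * cosh (\<beta> * x$2), deriv g (x$1) * sinh (\<beta> * x$2)]"
    and "partial 2 (rot_surface1 \<alpha> \<beta> f g) x =
      vector [f (x$1) * (- \<alpha> * sin (\<alpha> * x$2)), f (x$1) * (\<alpha> * cos (\<alpha> * x$2)),
              g (x$1) * (\<beta> * sinh (\<beta> * x$2)), g (x$1) * (\<beta> * cosh (\<beta> * x$2))]"
  unfolding rot_surface1_def [abs_def]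
  subgoal by (rule partial_rot_surface(1)[OF assms, where p = "\<lambda>v. cos (\<alpha> * v)" and q = "\<lambda>v. sin (\<alpha> * v)"
      and r = "\<lambda>v. cosh (\<beta> * v)" and s = "\<lambda>v. sinh (\<beta> * v)"])
  subgoal by (rule partial_rot_surface(2)[where p = "\<lambda>v. cos (\<alpha> * v)" and q = "\<lambda>v. sin (\<alpha> * v)"
      and r = "\<lambda>v. cosh (\<beta> * v)" and s = "\<lambda>v. sinh (\<beta> * v)"])
      (auto intro!: derivative_eq_intros)
  done

lemma partial_rot_surface2:
  assumes "f differentiable (at (x$1))" "g differentiable (at (x$1))"
  shows "partial 1 (rot_surface2 \<alpha> \<beta> f g) x =
      vector [deriv f (x$1) * cos (\<alpha> * x$2), deriv f (x$1) * sin (\<alpha> * x$2),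
              deriv g (x$1) * sinh (\<beta> * x$2), deriv g (x$1) * cosh (\<beta> * x$2)]"
    and "partial 2 (rot_surface2 \<alpha> \<beta> f g) x =
      vector [f (x$1) * (- \<alpha> * sin (\<alpha> * x$2)), f (x$1) * (\<alpha> * cos (\<alpha> * x$2)),
              g (x$1) * (\<beta> * cosh (\<beta> * x$2)), g (x$1) * (\<beta> * sinh (\<beta> * x$2))]"
  unfolding rot_surface2_def [abs_def]
  subgoal by (rule partial_rot_surface(1)[OF assms, where p = "\<lambda>v. cos (\<alpha> * v)" and q = "\<lambda>v. sin (\<alpha> * v)"
      and r = "\<lambda>v. sinh (\<beta> * v)" and s = "\<lambda>v. cosh (\<beta> * v)"])
  subgoal by (rule partial_rot_surface(2)[where p = "\<lambda>v. cos (\<alpha> * v)" and q = "\<lambda>v. sin (\<alpha> * v)"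
      and r = "\<lambda>v. sinh (\<beta> * v)" and s = "\<lambda>v. cosh (\<beta> * v)"])
      (auto intro!: derivative_eq_intros)
  done

lemma trig_aux:
  "a * sin t * (b * sin t) + a * cos t * (b * cos t) = a * (b::real)"
  "a * cosh t * (b * cosh t) - a * sinh t * (b * sinh t) = a * (b::real)"
proof -
  have "a * sin t * (b * sin t) + a * cos t * (b * cos t) = a * b * ((sin t)\<^sup>2 + (cos t)\<^sup>2)"
    by algebra
  then show "a * sin t * (b * sin t) + a * cos t * (b * cos t) = a * b"
    by simp
  have "a * cosh t * (b * cosh t) - a * sinh t * (b * sinh t) = a * b * ((cosh t)\<^sup>2 - (sinh t)\<^sup>2)"
    by algebra
  then show "a * cosh t * (b * cosh t) - a * sinh t * (b * sinh t) = a * b"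
    by (simp add: cosh_square_eq)
qed

lemma induced_metric_rot_surface1:
  assumes "f differentiable (at (x$1))" "g differentiable (at (x$1))"
  shows "induced_metric (rot_surface1 \<alpha> \<beta> f g) x =
    vector [vector [(deriv f (x$1))\<^sup>2 + (deriv g (x$1))\<^sup>2, 0],
            vector [0, \<alpha>\<^sup>2 * (f (x$1))\<^sup>2 - \<beta>\<^sup>2 * (g (x$1))\<^sup>2]]"
  using trig_aux(1)[of "deriv f (x$1)" "\<alpha> * x$2" "deriv f (x$1)"]
    trig_aux(2)[of "deriv g (x$1)" "\<beta> * x$2" "deriv g (x$1)"]
    trig_aux(1)[of "\<alpha> * f (x$1)" "\<alpha> * x$2" "\<alpha> * f (x$1)"]
    trig_aux(2)[of "\<beta> * g (x$1)" "\<beta> * x$2" "\<beta> * g (x$1)"]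
  unfolding induced_metric_def vec_eq_iff forall_2 mink_def
  by (simp add: partial_rot_surface1[OF assms] vector_4 power2_eq_square algebra_simps)

lemma induced_metric_rot_surface2:
  assumes "f differentiable (at (x$1))" "g differentiable (at (x$1))"
  shows "induced_metric (rot_surface2 \<alpha> \<beta> f g) x =
    vector [vector [(deriv f (x$1))\<^sup>2 - (deriv g (x$1))\<^sup>2, 0],
            vector [0, \<alpha>\<^sup>2 * (f (x$1))\<^sup>2 + \<beta>\<^sup>2 * (g (x$1))\<^sup>2]]"
  using trig_aux(1)[of "deriv f (x$1)" "\<alpha> * x$2" "deriv f (x$1)"]
    trig_aux(2)[of "deriv g (x$1)" "\<beta> * x$2" "deriv g (x$1)"]
    trig_aux(1)[of "\<alpha> * f (x$1)" "\<alpha> * x$2" "\<alpha> * f (x$1)"]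
    trig_aux(2)[of "\<beta> * g (x$1)" "\<beta> * x$2" "\<beta> * g (x$1)"]
  unfolding induced_metric_def vec_eq_iff forall_2 mink_def
  by (simp add: partial_rot_surface2[OF assms] vector_4 power2_eq_square algebra_simps)

lemma smooth_on_imp_differentiable: "smooth_on J f \<Longrightarrow> u \<in> J \<Longrightarrow> f differentiable (at u)"
  unfolding smooth_on_def by (metis funpow_0)

lemma diagonal_pos_def:
  fixes w :: "real ^ 2"
  assumes "a > 0" "b > 0" "w \<noteq> 0"
  shows "w \<bullet> ((vector [vector [a, 0], vector [0, b]] :: real ^ 2 ^ 2) *v w) > 0"
proof -
  have "w \<bullet> ((vector [vector [a, 0], vector [0, b]] :: real ^ 2 ^ 2) *v w)
      = a * (w$1)\<^sup>2 + b * (w$2)\<^sup>2"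
    by (simp add: inner_vec_def matrix_vector_mult_def sum_2 power2_eq_square algebra_simps)
  moreover have "w$1 \<noteq> 0 \<or> w$2 \<noteq> 0"
    using assms(3) by (simp add: vec_eq_iff forall_2)
  ultimately show ?thesis
    using assms(1,2) by (smt (verit) mult_nonneg_nonneg mult_pos_pos zero_le_power2 zero_less_power2)
qed

lemma spacelike_rot_surface1:
  assumes "smooth_on J f" "smooth_on J g"
    and "\<forall>u\<in>J. \<alpha>\<^sup>2 * (f u)\<^sup>2 - \<beta>\<^sup>2 * (g u)\<^sup>2 > 0 \<and> (deriv f u)\<^sup>2 + (deriv g u)\<^sup>2 > 0"
  shows "spacelike_on (rot_domain J) (rot_surface1 \<alpha> \<beta> f g)"
  unfolding spacelike_on_def rot_domain_def using assms
  by (auto simp: induced_metric_rot_surface1 smooth_on_imp_differentiable intro!: diagonal_pos_def)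

lemma spacelike_rot_surface2:
  assumes "smooth_on J f" "smooth_on J g"
    and "\<forall>u\<in>J. (deriv f u)\<^sup>2 - (deriv g u)\<^sup>2 > 0 \<and> \<alpha>\<^sup>2 * (f u)\<^sup>2 + \<beta>\<^sup>2 * (g u)\<^sup>2 > 0"
  shows "spacelike_on (rot_domain J) (rot_surface2 \<alpha> \<beta> f g)"
  unfolding spacelike_on_def rot_domain_def using assms
  by (auto simp: induced_metric_rot_surface2 smooth_on_imp_differentiable intro!: diagonal_pos_def)

end

(*
  Both surfaces have an induced metric of the form A(u) du^2 + B(u) dv^2, whose curvature is
  K = (A B'^2 + B A' B' - 2 A B B'') / (4 A^2 B^2).  Put s = 1 for the first type and s = -1 for the
  second, so that A = f'^2 + s g'^2 and B = \<alpha>^2 f^2 - s \<beta>^2 g^2.  Then the numerator of K is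
  4 s times the difference of the two sides of the asserted equation.
*)

theory Submission
  imports Defs
begin

text \<open>The metric and its Christoffel symbols have known formulas only over \<open>J\<close>.
  As \<open>J\<close> is open, a small move in direction 1 stays over \<open>J\<close>, so
  \<open>F\<close> and \<open>h\<close> agree near the point; a move in direction 2 leaves
  \<open>x$1\<close> fixed, so \<open>F\<close> is constant along it.\<close>

lemma partial_function_of_fst:
  fixes F :: "real ^ 2 \<Rightarrow> real"
  assumes "open J" "x$1 \<in> J" and F: "\<And>y. y$1 \<in> J \<Longrightarrow> F y = h (y$1)"
    and h: "(h has_real_derivative h') (at (x$1))"
  shows "partial 1 F x = h'" and "partial 2 F x = 0"
proof -
  have "((\<lambda>t. h (x$1 + t)) has_real_derivative h') (at 0)"
    using h DERIV_shift[of h h' 0 "x$1"] by (simp add: add.commute)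
  moreover have "open ((\<lambda>t. x$1 + t) -` J)"
    by (intro open_vimage \<open>open J\<close> continuous_intros)
  ultimately have "((\<lambda>t. F (x + t *\<^sub>R axis 1 1)) has_real_derivative h') (at 0)"
    using \<open>x$1 \<in> J\<close>
    by (elim has_field_derivative_transform_within_open) (auto simp: F axis_def)
  then show "partial 1 F x = h'"
    unfolding partial_def
    by (intro vector_derivative_at) (simp add: has_real_derivative_iff_has_vector_derivative)
  have "(\<lambda>t. F (x + t *\<^sub>R axis 2 1)) = (\<lambda>t. h (x$1))"
    using \<open>x$1 \<in> J\<close> by (auto simp: F axis_def)
  then show "partial 2 F x = 0"
    unfolding partial_def by simp
qed

lemma matrix_inv_diagonal_2:
  fixes a b :: real
  assumes "a \<noteq> 0" "b \<noteq> 0"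
  shows "matrix_inv (vector [vector [a, 0], vector [0, b]] :: real ^ 2 ^ 2)
    = vector [vector [1 / a, 0], vector [0, 1 / b]]"
  (is "matrix_inv ?M = ?N")
proof -
  have MN: "?M ** ?N = mat 1" and NM: "?N ** ?M = mat 1"
    using assms
    by (simp_all add: vec_eq_iff forall_2 matrix_matrix_mult_def sum_2 mat_def)
  then have "invertible ?M"
    by (auto simp: invertible_def)
  \<comment> \<open>\<open>matrix_inv\<close> is chosen among the two-sided inverses; once one
    exists, multiplying by \<open>?N\<close> on the right identifies the choice.\<close>
  then have "matrix_inv ?M ** ?M = mat 1"
    unfolding invertible_def matrix_inv_def by (metis (mono_tags, lifting) someI_ex)
  then have "matrix_inv ?M ** (?M ** ?N) = ?N"
    by (simp add: matrix_mul_assoc)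
  then show ?thesis
    by (simp add: MN)
qed

context
  fixes G :: "real ^ 2 \<Rightarrow> real ^ 2 ^ 2" and J :: "real set" and A A' B B' B'' :: "real \<Rightarrow> real"
  assumes J: "open J"
    and G: "\<And>x. x$1 \<in> J \<Longrightarrow> G x = vector [vector [A (x$1), 0], vector [0, B (x$1)]]"
    and nz: "\<And>u. u \<in> J \<Longrightarrow> A u \<noteq> 0" "\<And>u. u \<in> J \<Longrightarrow> B u \<noteq> 0"
    and A: "\<And>u. u \<in> J \<Longrightarrow> (A has_real_derivative A' u) (at u)"
    and B: "\<And>u. u \<in> J \<Longrightarrow> (B has_real_derivative B' u) (at u)"
    and B': "\<And>u. u \<in> J \<Longrightarrow> (B' has_real_derivative B'' u) (at u)"
begin

text \<open>Among all partial derivatives of the metric entries only A' and B', both in direction 1,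
  can be nonzero. The formulas hold at every point over \<open>J\<close>, so the symbols can be
  differentiated once more.\<close>

lemma christoffel_diagonal:
  assumes x: "x$1 \<in> J"
  shows "christoffel G 1 1 1 x = A' (x$1) / (2 * A (x$1))"
    and "christoffel G 2 1 1 x = 0"
    and "christoffel G 1 1 2 x = 0" and "christoffel G 1 2 1 x = 0"
    and "christoffel G 2 1 2 x = B' (x$1) / (2 * B (x$1))"
    and "christoffel G 2 2 1 x = B' (x$1) / (2 * B (x$1))"
    and "christoffel G 1 2 2 x = - B' (x$1) / (2 * A (x$1))"
    and "christoffel G 2 2 2 x = 0"
proof -
  note part = partial_function_of_fst[OF J x]
  have "partial 1 (\<lambda>y. G y $ 1 $ 1) x = A' (x$1)" "partial 2 (\<lambda>y. G y $ 1 $ 1) x = 0"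
    using part[where h = A, OF _ A[OF x], of "\<lambda>y. G y $ 1 $ 1"] by (simp_all add: G)
  moreover have "partial 1 (\<lambda>y. G y $ 2 $ 2) x = B' (x$1)" "partial 2 (\<lambda>y. G y $ 2 $ 2) x = 0"
    using part[where h = B, OF _ B[OF x], of "\<lambda>y. G y $ 2 $ 2"] by (simp_all add: G)
  moreover have "partial 1 (\<lambda>y. G y $ 1 $ 2) x = 0" "partial 2 (\<lambda>y. G y $ 1 $ 2) x = 0"
    "partial 1 (\<lambda>y. G y $ 2 $ 1) x = 0" "partial 2 (\<lambda>y. G y $ 2 $ 1) x = 0"
    using part[where h = "\<lambda>_. 0" and h' = 0, of "\<lambda>y. G y $ 1 $ 2"]
      part[where h = "\<lambda>_. 0" and h' = 0, of "\<lambda>y. G y $ 2 $ 1"] by (simp_all add: G)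
  ultimately show "christoffel G 1 1 1 x = A' (x$1) / (2 * A (x$1))"
    and "christoffel G 2 1 1 x = 0"
    and "christoffel G 1 1 2 x = 0" and "christoffel G 1 2 1 x = 0"
    and "christoffel G 2 1 2 x = B' (x$1) / (2 * B (x$1))"
    and "christoffel G 2 2 1 x = B' (x$1) / (2 * B (x$1))"
    and "christoffel G 1 2 2 x = - B' (x$1) / (2 * A (x$1))"
    and "christoffel G 2 2 2 x = 0"
    using nz[OF x]
    by (simp_all add: christoffel_def sum_2 G x matrix_inv_diagonal_2)
qed

lemma gauss_curvature_diagonal:
  assumes x: "x$1 \<in> J"
  defines "u \<equiv> x$1"
  shows "gauss_curvature G x
    = (A u * (B' u)\<^sup>2 + B u * A' u * B' u - 2 * A u * B u * B'' u) / (4 * (A u)\<^sup>2 * (B u)\<^sup>2)"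
proof -
  have u: "u \<in> J" using x by (simp add: u_def)
  \<comment> \<open>The function differentiated here is the symbol
    \<open>christoffel G 1 2 2\<close>, the only one whose derivative survives in the curvature
    component below.\<close>
  have d: "((\<lambda>u. - B' u / (2 * A u)) has_real_derivative
      (B' u * A' u - B'' u * A u) / (2 * (A u)\<^sup>2)) (at u)"
    using nz(1)[OF u]
    by (auto intro!: derivative_eq_intros A[OF u] B'[OF u] simp: divide_simps power2_eq_square)
  have "partial 1 (christoffel G 1 2 2) x = (B' u * A' u - B'' u * A u) / (2 * (A u)\<^sup>2)"
    by (rule partial_function_of_fst(1)[OF J x _ d[unfolded u_def], folded u_def])
      (simp add: christoffel_diagonal)
  moreover have "partial 2 (christoffel G 1 1 2) x = 0"
    by (rule partial_function_of_fst(2)[OF J x, where h = "\<lambda>_. 0" and h' = 0])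
      (simp_all add: christoffel_diagonal)
  \<comment> \<open>With upper index first, the surviving quadratic terms are Gamma^1_11 Gamma^1_22
    and - Gamma^1_22 Gamma^2_12.\<close>
  ultimately have R: "riemann G 1 1 2 2 x = (B' u * A' u - B'' u * A u) / (2 * (A u)\<^sup>2)
      - A' u * B' u / (4 * (A u)\<^sup>2) + (B' u)\<^sup>2 / (4 * A u * B u)"
    unfolding riemann_def
    by (simp add: sum_2 christoffel_diagonal[OF x] u_def[symmetric] power2_eq_square)
  \<comment> \<open>The summand l = 2 carries the zero off-diagonal entry of \<open>G\<close>, so K
    = A R / (A B) = R / B, where R is the component just computed.\<close>
  show ?thesis
    using nz[OF u]
    unfolding gauss_curvature_def sum_2 R
    by (simp add: G[OF x] det_2 u_def[symmetric])
      (simp add: divide_simps, simp add: algebra_simps power2_eq_square)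
qed

end

text \<open>The surface enters only through its metric matrix, so the sign \<open>s\<close> lets one
  computation serve both types.\<close>

lemma flat_rotational_metric_iff:
  fixes \<alpha> \<beta> s :: real and f g :: "real \<Rightarrow> real" and z :: "real ^ 2 \<Rightarrow> real ^ 4"
  defines "A \<equiv> \<lambda>u. (deriv f u)\<^sup>2 + s * (deriv g u)\<^sup>2"
    and "B \<equiv> \<lambda>u. \<alpha>\<^sup>2 * (f u)\<^sup>2 - s * \<beta>\<^sup>2 * (g u)\<^sup>2"
  assumes s: "s\<^sup>2 = 1" and J: "open J" and smooth: "smooth_on J f" "smooth_on J g"
    and metric: "\<And>x. x$1 \<in> J \<Longrightarrow>
      induced_metric z x = vector [vector [A (x$1), 0], vector [0, B (x$1)]]"
    and nz: "\<And>u. u \<in> J \<Longrightarrow> A u \<noteq> 0" "\<And>u. u \<in> J \<Longrightarrow> B u \<noteq> 0"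
  shows "flat_on (rot_domain J) z \<longleftrightarrow>
    (\<forall>u\<in>J. \<alpha>\<^sup>2 * \<beta>\<^sup>2 * A u * (g u * deriv f u - f u * deriv g u)\<^sup>2 =
      B u * (\<alpha>\<^sup>2 * f u * deriv g u + \<beta>\<^sup>2 * g u * deriv f u) *
      (deriv g u * deriv (deriv f) u - deriv f u * deriv (deriv g) u))"
    (is "_ \<longleftrightarrow> (\<forall>u\<in>J. ?L u = ?R u)")
proof -
  define A' where "A' = (\<lambda>u. 2 * (deriv f u * deriv (deriv f) u + s * deriv g u * deriv (deriv g) u))"
  define B' where "B' = (\<lambda>u. 2 * (\<alpha>\<^sup>2 * f u * deriv f u - s * \<beta>\<^sup>2 * g u * deriv g u))"
  define B'' where "B'' = (\<lambda>u. 2 * (\<alpha>\<^sup>2 * ((deriv f u)\<^sup>2 + f u * deriv (deriv f) u)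
    - s * \<beta>\<^sup>2 * ((deriv g u)\<^sup>2 + g u * deriv (deriv g) u)))"
  have D: "(h has_real_derivative deriv h u) (at u)"
    "(deriv h has_real_derivative deriv (deriv h) u) (at u)"
    if "smooth_on J h" "u \<in> J" for h u
  proof -
    have "(deriv ^^ 0) h differentiable (at u)" "(deriv ^^ 1) h differentiable (at u)"
      using that unfolding smooth_on_def by blast+
    then show "(h has_real_derivative deriv h u) (at u)"
      "(deriv h has_real_derivative deriv (deriv h) u) (at u)"
      by (simp_all add: DERIV_deriv_iff_real_differentiable)
  qed
  note [derivative_intros] = D[OF smooth(1)] D[OF smooth(2)]
  have DA: "(A has_real_derivative A' u) (at u)" if "u \<in> J" for u
    unfolding A_def A'_def using that by (auto intro!: derivative_eq_intros simp: algebra_simps)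
  have DB: "(B has_real_derivative B' u) (at u)" if "u \<in> J" for u
    unfolding B_def B'_def using that by (auto intro!: derivative_eq_intros simp: algebra_simps)
  have DB': "(B' has_real_derivative B'' u) (at u)" if "u \<in> J" for u
    unfolding B'_def B''_def using that
    by (auto intro!: derivative_eq_intros simp: algebra_simps power2_eq_square)
  \<comment> \<open>A polynomial identity in the values of f, g and their first two derivatives. The
    part without second derivatives, A B'^2 minus 4 A B (\<alpha>^2 f'^2 - s \<beta>^2 g'^2), gives
    4 s \<open>?L\<close>; the rest gives - 4 s \<open>?R\<close>. Both use s^2 = 1 for
    cancellation.\<close>
  have num: "A u * (B' u)\<^sup>2 + B u * A' u * B' u - 2 * A u * B u * B'' u = 4 * s * (?L u - ?R u)" for u
  proof -
    have "s = 1 \<or> s = - 1" using s by (simp add: power2_eq_1_iff)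
    then show ?thesis
    proof
      assume "s = 1"
      show ?thesis
        unfolding A_def B_def A'_def B'_def B''_def \<open>s = 1\<close> by algebra
    next
      assume "s = - 1"
      show ?thesis
        unfolding A_def B_def A'_def B'_def B''_def \<open>s = - 1\<close> by algebra
    qed
  qed
  \<comment> \<open>The denominator 4 A^2 B^2 and the factor 4 s are nonzero.\<close>
  have K: "gauss_curvature (induced_metric z) x = 0 \<longleftrightarrow> ?L (x$1) = ?R (x$1)" if "x$1 \<in> J" for x
    using s nz[OF that]
    by (subst gauss_curvature_diagonal[OF J metric nz DA DB DB' that]) (auto simp: num)
  have "flat_on (rot_domain J) z \<longleftrightarrow> (\<forall>x\<in>rot_domain J. ?L (x$1) = ?R (x$1))"
    unfolding flat_on_def by (intro ball_cong refl K) (simp add: rot_domain_def)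
  also have "\<dots> \<longleftrightarrow> (\<forall>u\<in>J. ?L u = ?R u)"
  proof (intro iffI ballI)
    fix u assume H: "\<forall>x\<in>rot_domain J. ?L (x$1) = ?R (x$1)" and "u \<in> J"
    \<comment> \<open>The equation does not involve v, so one admissible value, v = 0, is enough for
      each u.\<close>
    then have "vector [u, 0] \<in> rot_domain J" by (simp add: rot_domain_def)
    with H show "?L u = ?R u" by force
  qed (simp add: rot_domain_def)
  finally show ?thesis .
qed

theorem theorem3p2:
  fixes \<alpha> \<beta> :: real and J :: "real set" and f g :: "real \<Rightarrow> real"
  assumes "\<alpha> > 0" and "\<beta> > 0"
    and "open J" and "is_interval J"
    and "smooth_on J f" and "smooth_on J g"
  shows
    "((\<forall>u\<in>J. \<alpha>\<^sup>2 * (f u)\<^sup>2 - \<beta>\<^sup>2 * (g u)\<^sup>2 > 0 \<and> (deriv f u)\<^sup>2 + (deriv g u)\<^sup>2 > 0) \<longrightarrow>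
       (flat_on (rot_domain J) (rot_surface1 \<alpha> \<beta> f g) \<longleftrightarrow>
        (\<forall>u\<in>J. \<alpha>\<^sup>2 * \<beta>\<^sup>2 * ((deriv f u)\<^sup>2 + (deriv g u)\<^sup>2) * (g u * deriv f u - f u * deriv g u)\<^sup>2 =
                (\<alpha>\<^sup>2 * (f u)\<^sup>2 - \<beta>\<^sup>2 * (g u)\<^sup>2) *
                (\<alpha>\<^sup>2 * f u * deriv g u + \<beta>\<^sup>2 * g u * deriv f u) *
                (deriv g u * deriv (deriv f) u - deriv f u * deriv (deriv g) u)))) \<and>
     ((\<forall>u\<in>J. (deriv f u)\<^sup>2 - (deriv g u)\<^sup>2 > 0 \<and> \<alpha>\<^sup>2 * (f u)\<^sup>2 + \<beta>\<^sup>2 * (g u)\<^sup>2 > 0) \<longrightarrow>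
       (flat_on (rot_domain J) (rot_surface2 \<alpha> \<beta> f g) \<longleftrightarrow>
        (\<forall>u\<in>J. \<alpha>\<^sup>2 * \<beta>\<^sup>2 * ((deriv f u)\<^sup>2 - (deriv g u)\<^sup>2) * (g u * deriv f u - f u * deriv g u)\<^sup>2 =
                (\<alpha>\<^sup>2 * (f u)\<^sup>2 + \<beta>\<^sup>2 * (g u)\<^sup>2) *
                (\<alpha>\<^sup>2 * f u * deriv g u + \<beta>\<^sup>2 * g u * deriv f u) *
                (deriv g u * deriv (deriv f) u - deriv f u * deriv (deriv g) u))))"
proof (intro conjI impI, goal_cases)
  case 1
  then have "(deriv f u)\<^sup>2 + (deriv g u)\<^sup>2 \<noteq> 0" "\<alpha>\<^sup>2 * (f u)\<^sup>2 - \<beta>\<^sup>2 * (g u)\<^sup>2 \<noteq> 0"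
    if "u \<in> J" for u
    using that by fastforce+
  \<comment> \<open>Deleting \<open>sum_power2_eq_zero_iff\<close> stops the simplifier from
    splitting a vanishing sum of squares into two equations, so the nonvanishing facts keep the
    shape of the hypotheses they discharge.\<close>
  then show ?case
    using flat_rotational_metric_iff[of "1" J f g "rot_surface1 \<alpha> \<beta> f g" \<alpha> \<beta>] assms
    by (simp add: induced_metric_rot_surface1 smooth_on_imp_differentiable del: sum_power2_eq_zero_iff)
next
  case 2
  then have "(deriv f u)\<^sup>2 - (deriv g u)\<^sup>2 \<noteq> 0" "\<alpha>\<^sup>2 * (f u)\<^sup>2 + \<beta>\<^sup>2 * (g u)\<^sup>2 \<noteq> 0"
    if "u \<in> J" for u
    using that by fastforce+
  then show ?case
    using flat_rotational_metric_iff[of "- 1" J f g "rot_surface2 \<alpha> \<beta> f g" \<alpha> \<beta>] assms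
    by (simp add: induced_metric_rot_surface2 smooth_on_imp_differentiable del: sum_power2_eq_zero_iff)
qed

end
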